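(* Let $n,k\in\mathbb{N}_0$ and let $(\alpha,\beta,r)\neq(0,0,0)$ be a triple in $\mathbb{R}^3$ or $\mathbb{C}^3$. Then the generalized Stirling numbers satisfy $$S(n,k,\alpha,\beta,r)=\underline{\triangle}^k_\beta\langle z\rangle_{n,-\alpha}\Big|_{z=r}=\begin{cases}\dfrac{1}{\beta^k k!}\,\Delta_\beta^k\langle z\rangle_{n,-\alpha}\Big|_{z=r}=[r,r+\beta,\dots,r+k\beta]\,\langle z\rangle_{n,-\alpha}, & \beta\neq 0,\\[2mm] \dfrac{1}{k!}\,D^k\langle z\rangle_{n,-\alpha}\Big|_{z=r}, & \beta=0.\end{cases}$$ In particular, for the generalized Stirling number pair $S^1(n,k)=S(n,k,\alpha,\beta,r)$, $S^2(n,k)=S(n,k,\beta,\alpha,-r)$ one has $$S^1(n,k)=\underline{\triangle}^k_\beta\langle z\rangle_{n,-\alpha}\Big|_{z=r}=\begin{cases}\dfrac{1}{\beta^k k!}\,\Delta_\beta^k\langle z\rangle_{n,-\alpha}\Big|_{z=r}=[r,r+\beta,\dots,r+k\beta]\,\langle z\rangle_{n,-\alpha}, & \beta\neq 0,\\[2mm] \dfrac{1}{k!}\,D^k\langle z\rangle_{n,-\alpha}\Big|_{z=r}, & \beta=0,\end{cases}$$ $$S^2(n,k)=\underline{\triangle}^k_\alpha\langle z\rangle_{n,-\beta}\Big|_{z=-r}=\begin{cases}\dfrac{1}{\alpha^k k!}\,\Delta_\alpha^k\langle z\rangle_{n,-\beta}\Big|_{z=-r}=[-r,-r+\alpha,\dots,-r+k\alpha]\,\langle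 z\rangle_{n,-\beta}, & \alpha\neq 0,\\[2mm] \dfrac{1}{k!}\,D^k\langle z\rangle_{n,-\beta}\Big|_{z=-r}, & \alpha=0.\end{cases}$$ Furthermore, for $(\alpha,\beta,r)=(1,0,0)$ this gives the classical Stirling numbers of the first kind, $s(n,k)=S(n,k,1,0,0)=\frac{1}{k!}D^k[z]_n\big|_{z=0}$, and for $(\alpha,\beta,r)=(0,1,0)$ it gives the classical Stirling numbers of the second kind, $S(n,k)=S(n,k,0,1,0)=[0,1,2,\dots,k]\,z^n$ (the divided difference of the function $z\mapsto z^n$ at the points $0,1,\dots,k$).
   Context: For a number $\alpha$ and $n\in\mathbb{N}_0$, $\langle z\rangle_{n,\alpha}:=z(z+\alpha)\cdots(z+(n-1)\alpha)$, with $\langle z\rangle_{0,\alpha}=1$; so $\langle z\rangle_{n,-\alpha}=z(z-\alpha)\cdots(z-(n-1)\alpha)$, $\langle z\rangle_{n,-1}=[z]_n$ is the falling factorial and $\langle z\rangle_{n,0}=z^n$. The generalized Stirling numbers $S(n,k,\alpha,\beta,r)$, $0\le k\le n$, are defined as the unique coefficients in the polynomial identity in $z$ $$\langle z\rangle_{n,-\alpha}=\sum_{k=0}^n S(n,k,\alpha,\beta,r)\,\langle z-r\rangle_{k,-\beta},$$ with $S(n,k,\alpha,\beta,r)=0$ for $k>n$. Thus the pair $S^1,S^2$ satisfies $\langle z\rangle_{n,-\alpha}=\sum_k S^1(n,k)\langle z-r\rangle_{k,-\beta}$ and $\langle z\rangle_{n,-\beta}=\sum_k S^2(n,k)\langle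 z+r\rangle_{k,-\alpha}$. The classical Stirling numbers are defined by $[z]_n=\sum_{k=0}^n s(n,k)z^k$ and $z^n=\sum_{k=0}^n S(n,k)[z]_k$. The difference operator is $\Delta_\beta f(t)=f(t+\beta)-f(t)$, $\Delta_\beta^k=\Delta_\beta\circ\Delta_\beta^{k-1}$ ($\Delta_\beta^0$ the identity), and $[t_0,\dots,t_k]f$ denotes the $k$th divided difference of $f$ at the points $t_0,\dots,t_k$. The generalized divided difference is $\underline{\triangle}^k_\beta f(t):=\frac{1}{\beta^k k!}\Delta^k_\beta f(t)=[t,t+\beta,\dots,t+k\beta]f$ if $\beta\neq0$, and $\underline{\triangle}^k_0 f(t):=\frac1{k!}D^kf(t)$, where $D^k$ is the $k$th derivative. *)

theory Defs
  imports "HOL-Analysis.Analysis" "HOL-Combinatorics.Stirling"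
    "HOL-Computational_Algebra.Polynomial"
begin

text \<open>
  Scalars range over a \<^class>\<open>real_normed_field\<close>, which covers both \<^typ>\<open>real\<close> and
  \<^typ>\<open>complex\<close>. Since such a field is infinite, a polynomial identity in \<open>z\<close> is the same as
  an identity of values for all \<open>z\<close>.
\<close>

definition gfact :: "'a::comm_semiring_1 \<Rightarrow> nat \<Rightarrow> 'a \<Rightarrow> 'a"  (* \<open>\<langle>z\<rangle>\<^sub>n\<^sub>,\<^sub>\<alpha>\<close> *)
  where "gfact z n \<alpha> = (\<Prod>i<n. z + of_nat i * \<alpha>)"

definition falling_fact :: "'a::comm_ring_1 \<Rightarrow> nat \<Rightarrow> 'a"
  where "falling_fact z n = gfact z n (-1)"

text \<open>
  In the next three definitions the clause \<open>\<forall>j>n. c j = 0\<close> is the convention that the numbers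
  vanish for \<open>k > n\<close>; it also makes the description definite, see \<open>gen_stirling_ex1\<close>,
  \<open>stirling_fst_ex1\<close> and \<open>stirling_snd_ex1\<close> below.
\<close>

definition gen_stirling ::
    "nat \<Rightarrow> nat \<Rightarrow> 'a::real_normed_field \<Rightarrow> 'a \<Rightarrow> 'a \<Rightarrow> 'a"
  where "gen_stirling n k \<alpha> \<beta> r =
    (THE c. (\<forall>j>n. c j = 0) \<and>
            (\<forall>z. gfact z n (-\<alpha>) = (\<Sum>j\<le>n. c j * gfact (z - r) j (-\<beta>)))) k"

definition stirling_fst :: "nat \<Rightarrow> nat \<Rightarrow> 'a::real_normed_field"
  where "stirling_fst n k =
    (THE c. (\<forall>j>n. c j = 0) \<and>
            (\<forall>z. falling_fact z n = (\<Sum>j\<le>n. c j * z ^ j))) k"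

definition stirling_snd :: "nat \<Rightarrow> nat \<Rightarrow> 'a::real_normed_field"
  where "stirling_snd n k =
    (THE c. (\<forall>j>n. c j = 0) \<and>
            (\<forall>z. z ^ n = (\<Sum>j\<le>n. c j * falling_fact z j))) k"

definition fdiff :: "'a::ab_group_add \<Rightarrow> ('a \<Rightarrow> 'a) \<Rightarrow> 'a \<Rightarrow> 'a"
  where "fdiff \<beta> f = (\<lambda>t. f (t + \<beta>) - f t)"

text \<open>
  \<open>divided_difference f t k\<close> is \<open>[t 0, \<dots>, t k]f\<close>, by the usual recursion
  \<open>[t\<^sub>0,\<dots>,t\<^sub>k\<^sub>+\<^sub>1]f = ([t\<^sub>1,\<dots>,t\<^sub>k\<^sub>+\<^sub>1]f - [t\<^sub>0,\<dots>,t\<^sub>k]f) / (t\<^sub>k\<^sub>+\<^sub>1 - t\<^sub>0)\<close>. It is meaningful only for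
  pairwise distinct points (no confluent case).
\<close>
primrec divided_difference ::
    "('a \<Rightarrow> 'a::field) \<Rightarrow> (nat \<Rightarrow> 'a) \<Rightarrow> nat \<Rightarrow> 'a"
  where
    "divided_difference f t 0 = f (t 0)"
  | "divided_difference f t (Suc k) =
       (divided_difference f (\<lambda>i. t (Suc i)) k - divided_difference f t k) / (t (Suc k) - t 0)"

definition gen_divided_difference ::
    "'a::real_normed_field \<Rightarrow> nat \<Rightarrow> ('a \<Rightarrow> 'a) \<Rightarrow> 'a \<Rightarrow> 'a"
  where "gen_divided_difference \<beta> k f t =
    (if \<beta> \<noteq> 0 then 1 / (\<beta> ^ k * fact k) * (fdiff \<beta> ^^ k) f t
     else 1 / fact k * (deriv ^^ k) f t)"


text \<open>The descriptions above are definite, and the classical numbers are those of the library.\<close>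

lemma newton_expansion_ex:
  fixes p :: "'a::field_char_0 poly"
  assumes "degree p \<le> n"
  shows "\<exists>c. (\<forall>j>n. c j = 0) \<and> (\<forall>z. poly p z = (\<Sum>j\<le>n. c j * gfact (z - r) j (-b)))"
  using assms
proof (induction n arbitrary: p)
  case 0
  then obtain a where "p = [:a:]" by (metis degree_eq_zeroE le_zero_eq)
  then show ?case
    by (intro exI[of _ "\<lambda>j. if j = 0 then a else 0"]) (auto simp: gfact_def)
next
  case (Suc n)
  define B where "B = (\<Prod>i<Suc n. [:- r - of_nat i * b, 1:])"
  have B: "poly B z = gfact (z - r) (Suc n) (-b)" for z
    unfolding B_def gfact_def poly_prod by (intro prod.cong) (auto simp: algebra_simps)
  have dB: "degree B = Suc n" unfolding B_def by (subst degree_prod_eq_sum_degree) auto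
  have lB: "coeff B (Suc n) = 1"
    using lead_coeff_prod[of "\<lambda>i. [:- r - of_nat i * b, 1:]" "{..<Suc n}"] dB
    unfolding B_def by simp
  define a where "a = coeff p (Suc n)"
  define q where "q = p - smult a B"
  have "degree q \<le> Suc n" unfolding q_def
    using Suc.prems dB by (intro degree_diff_le) (auto intro: order_trans[OF degree_smult_le])
  moreover have "coeff q (Suc n) = 0" by (simp add: q_def a_def lB)
  ultimately have "degree q \<le> n"
    by (metis Suc_leI coeff_0 degree_0 le_SucE le_degree leading_coeff_0_iff zero_le)
  from Suc.IH[OF this] obtain c where c: "\<forall>j>n. c j = 0"
    "\<forall>z. poly q z = (\<Sum>j\<le>n. c j * gfact (z - r) j (-b))" by blast
  have "poly p z = poly q z + a * poly B z" for z by (simp add: q_def)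
  then show ?case using c B
    by (intro exI[of _ "c(Suc n := a)"]) auto
qed

lemma newton_expansion_zero:
  fixes c :: "nat \<Rightarrow> 'a::field_char_0"
  assumes "\<forall>z. (\<Sum>j\<le>n. c j * gfact (z - r) j (-b)) = 0" and "j \<le> n"
  shows "c j = 0"
  using assms
proof (induction n arbitrary: j)
  case 0
  then show ?case by (simp add: gfact_def)
next
  case (Suc n)
  define B where "B = (\<lambda>j. \<Prod>i<j. [:- r - of_nat i * b, 1:])"
  have B: "poly (B j) z = gfact (z - r) j (-b)" for z j
    unfolding B_def gfact_def poly_prod by (intro prod.cong) (auto simp: algebra_simps)
  have dB: "degree (B j) = j" for j unfolding B_def
    by (subst degree_prod_eq_sum_degree) auto
  have lB: "coeff (B j) j = 1" for j
    using lead_coeff_prod[of "\<lambda>i. [:- r - of_nat i * b, 1:]" "{..<j}"] dB[of j]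
    unfolding B_def by simp
  have "poly (\<Sum>j\<le>Suc n. smult (c j) (B j)) z = poly 0 z" for z
    using Suc.prems(1) by (simp add: poly_sum B)
  then have "(\<Sum>j\<le>Suc n. smult (c j) (B j)) = 0" by (rule poly_ext)
  then have "coeff (\<Sum>j\<le>Suc n. smult (c j) (B j)) (Suc n) = 0" by simp
  then have "(\<Sum>j\<le>Suc n. c j * coeff (B j) (Suc n)) = 0" by (simp add: coeff_sum)
  moreover have "coeff (B j) (Suc n) = 0" if "j \<le> n" for j
    using that dB[of j] by (intro coeff_eq_0) auto
  ultimately have "c (Suc n) = 0" using lB[of "Suc n"] by simp
  with Suc show ?case by (cases "j = Suc n") auto
qed

lemma newton_expansion_ex1:
  fixes p :: "'a::field_char_0 poly"
  assumes "degree p \<le> n"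
  shows "\<exists>!c. (\<forall>j>n. c j = 0) \<and> (\<forall>z. poly p z = (\<Sum>j\<le>n. c j * gfact (z - r) j (-b)))"
proof (rule ex_ex1I)
  show "\<exists>c. (\<forall>j>n. c j = 0) \<and> (\<forall>z. poly p z = (\<Sum>j\<le>n. c j * gfact (z - r) j (-b)))"
    using assms by (rule newton_expansion_ex)
next
  fix c d
  assume c: "(\<forall>j>n. c j = 0) \<and> (\<forall>z. poly p z = (\<Sum>j\<le>n. c j * gfact (z - r) j (-b)))"
    and d: "(\<forall>j>n. d j = 0) \<and> (\<forall>z. poly p z = (\<Sum>j\<le>n. d j * gfact (z - r) j (-b)))"
  have "\<forall>z. (\<Sum>j\<le>n. (c j - d j) * gfact (z - r) j (-b)) = 0"
    using c d by (simp add: left_diff_distrib sum_subtractf)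
  then have "c j - d j = 0" if "j \<le> n" for j
    using newton_expansion_zero[where c = "\<lambda>j. c j - d j"] that by blast
  then show "c = d" using c d by (intro ext) (metis linorder_not_le right_minus_eq)
qed

theorem gen_stirling_ex1:
  fixes \<alpha> \<beta> r :: "'a::real_normed_field"
  shows "\<exists>!c. (\<forall>j>n. c j = 0) \<and>
              (\<forall>z. gfact z n (-\<alpha>) = (\<Sum>j\<le>n. c j * gfact (z - r) j (-\<beta>)))"
proof -
  let ?p = "\<Prod>i<n. [:- of_nat i * \<alpha>, 1:]"
  have "degree ?p \<le> n" by (subst degree_prod_eq_sum_degree) auto
  moreover have "poly ?p z = gfact z n (-\<alpha>)" for z
    unfolding gfact_def poly_prod by (intro prod.cong) (auto simp: algebra_simps)
  ultimately show ?thesis using newton_expansion_ex1[of ?p n r \<beta>] by simp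
qed

lemma gfact_zero_step: "gfact z n 0 = z ^ n"
  by (simp add: gfact_def)

corollary stirling_fst_ex1:
  "\<exists>!c :: nat \<Rightarrow> 'a::real_normed_field. (\<forall>j>n. c j = 0) \<and>
     (\<forall>z. falling_fact z n = (\<Sum>j\<le>n. c j * z ^ j))"
  using gen_stirling_ex1[of n 1 0 0] by (simp add: falling_fact_def gfact_zero_step)

corollary stirling_snd_ex1:
  "\<exists>!c :: nat \<Rightarrow> 'a::real_normed_field. (\<forall>j>n. c j = 0) \<and>
     (\<forall>z. z ^ n = (\<Sum>j\<le>n. c j * falling_fact z j))"
  using gen_stirling_ex1[of n 0 0 1] by (simp add: falling_fact_def gfact_zero_step)

lemma stirling_fst_eq:
  "stirling_fst n k = (-1) ^ (n + k) * (of_nat (stirling n k) :: 'a::real_normed_field)"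
proof -
  let ?c = "\<lambda>k. (-1) ^ (n + k) * (of_nat (stirling n k) :: 'a)"
  have "falling_fact z n = (\<Sum>j\<le>n. ?c j * z ^ j)" for z :: 'a
  proof -
    have "falling_fact z n = (\<Prod>i<n. (-1) * (- z + of_nat i))"
      unfolding falling_fact_def gfact_def by (intro prod.cong) auto
    also have "\<dots> = (-1) ^ n * pochhammer (- z) n"
      by (subst prod.distrib) (simp add: pochhammer_prod atLeast0LessThan)
    also have "\<dots> = (-1) ^ n * (\<Sum>j\<le>n. of_nat (stirling n j) * (- z) ^ j)"
      by (simp add: stirling_pochhammer)
    also have "\<dots> = (\<Sum>j\<le>n. ?c j * z ^ j)"
      unfolding sum_distrib_left
      by (intro sum.cong refl, subst power_minus) (simp add: power_add mult_ac)
    finally show ?thesis .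
  qed
  then have "(THE c. (\<forall>j>n. c j = 0) \<and> (\<forall>z. falling_fact z n = (\<Sum>j\<le>n. c j * z ^ j))) = ?c"
    by (intro the1_equality[OF stirling_fst_ex1]) auto
  then show ?thesis unfolding stirling_fst_def by simp
qed

lemma power_eq_sum_Stirling:
  "z ^ n = (\<Sum>j\<le>n. of_nat (Stirling n j) * falling_fact (z::'a::comm_ring_1) j)"
proof (induction n)
  case 0
  then show ?case by (simp add: falling_fact_def gfact_def)
next
  case (Suc n)
  let ?F = "falling_fact z"
  let ?S = "\<lambda>n j. of_nat (Stirling n j) :: 'a"
  have F: "z * ?F j = ?F (Suc j) + of_nat j * ?F j" for j
    by (simp add: falling_fact_def gfact_def algebra_simps)
  have "z ^ Suc n = (\<Sum>j\<le>n. ?S n j * (z * ?F j))"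
    by (simp add: Suc.IH sum_distrib_left mult_ac)
  also have "\<dots> = (\<Sum>j\<le>n. ?S n j * ?F (Suc j)) + (\<Sum>j\<le>Suc n. of_nat j * ?S n j * ?F j)"
    by (simp add: F distrib_left sum.distrib mult_ac)
  also have "(\<Sum>j\<le>Suc n. of_nat j * ?S n j * ?F j) =
             (\<Sum>j\<le>n. of_nat (Suc j) * ?S n (Suc j) * ?F (Suc j))"
    by (subst sum.atMost_Suc_shift) simp
  also have "(\<Sum>j\<le>n. ?S n j * ?F (Suc j)) + \<dots> = (\<Sum>j\<le>n. ?S (Suc n) (Suc j) * ?F (Suc j))"
    by (simp add: sum.distrib[symmetric] algebra_simps)
  also have "\<dots> = (\<Sum>j\<le>Suc n. ?S (Suc n) j * ?F j)"
    by (simp only: sum.atMost_Suc_shift) simp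
  finally show ?case .
qed

lemma stirling_snd_eq:
  "stirling_snd n k = (of_nat (Stirling n k) :: 'a::real_normed_field)"
proof -
  have "(THE c. (\<forall>j>n. c j = (0::'a)) \<and> (\<forall>z. z ^ n = (\<Sum>j\<le>n. c j * falling_fact z j))) =
        (\<lambda>k. of_nat (Stirling n k))"
    by (intro the1_equality[OF stirling_snd_ex1]) (auto intro: power_eq_sum_Stirling)
  then show ?thesis unfolding stirling_snd_def by simp
qed

end

theory Submission
  imports Defs
begin

text \<open>
  Write \<open>B\<^sub>j(z) = \<langle>z - r\<rangle>\<^sub>j\<^sub>,\<^sub>-\<^sub>\<beta>\<close> for the Newton basis in which the generalized Stirling numbers are
  coefficients. The operator \<open>\<Delta>\<^sub>\<beta>\<close> lowers this basis exactly as differentiation lowers the powers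
  of \<open>z - r\<close>: \<open>\<Delta>\<^sub>\<beta> B\<^sub>j = \<beta> j B\<^sub>j\<^sub>-\<^sub>1\<close> for \<open>\<beta> \<noteq> 0\<close>, and \<open>D B\<^sub>j = j B\<^sub>j\<^sub>-\<^sub>1\<close> for \<open>\<beta> = 0\<close>, where \<open>B\<^sub>j\<close> is a
  power. Since \<open>B\<^sub>j(r)\<close> is 1 for \<open>j = 0\<close> and 0 otherwise, applying such an operator \<open>k\<close> times and
  evaluating at \<open>r\<close> isolates the \<open>k\<close>th coefficient, multiplied by \<open>\<beta>\<^sup>k k!\<close> or by \<open>k!\<close>. This is
  Newton's interpolation formula in the first case and Taylor's formula in the second;
  \<open>lowering_operator_coefficient\<close> proves both at once. Applied to the defining expansion of
  \<open>\<langle>z\<rangle>\<^sub>n\<^sub>,\<^sub>-\<^sub>\<alpha>\<close> it gives \<open>gen_stirling_eq_gen_divided_difference\<close>.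

  What is left is to pass from iterated differences to divided differences at equidistant points
  (\<open>divided_difference_equidistant\<close>), and to observe that the expansions defining the classical
  Stirling numbers are the instances \<open>(1, 0, 0)\<close> and \<open>(0, 1, 0)\<close> of the general one.
\<close>

text \<open>
  A common form of Newton's and Taylor's formulas: \<open>D\<close> plays the role of \<open>\<Delta>\<^sub>\<beta>\<close> with \<open>s = \<beta>\<close>, or of
  the derivative with \<open>s = 1\<close>. One application of \<open>D\<close> turns the coefficient sequence \<open>c\<close> into
  \<open>s (j + 1) c\<^sub>j\<^sub>+\<^sub>1\<close>, so \<open>k\<close> applications move \<open>c\<^sub>k\<close> to the constant term.
\<close>
lemma lowering_operator_coefficient:
  fixes D :: "('a \<Rightarrow> 'a) \<Rightarrow> 'a \<Rightarrow> 'a::field_char_0"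
  assumes lower: "\<And>c. D (\<lambda>z. \<Sum>j\<le>n. c j * B j z) =
                       (\<lambda>z. \<Sum>j\<le>n. c j * (s * of_nat j * B (j - 1) z))"
    and B_base: "\<And>j. B j r = (if j = 0 then 1 else 0)"
    and support: "\<forall>j>n. c j = 0"
  shows "(D ^^ k) (\<lambda>z. \<Sum>j\<le>n. c j * B j z) r = s ^ k * fact k * c k"
  using support
proof (induction k arbitrary: c)
  case 0
  then show ?case by (simp add: B_base if_distrib cong: if_cong)
next
  case (Suc k)
  let ?c = "\<lambda>j. s * of_nat (Suc j) * c (Suc j)"
  have "D (\<lambda>z. \<Sum>j\<le>n. c j * B j z) = (\<lambda>z. \<Sum>j\<le>n. ?c j * B j z)"
  proof
    fix z
    (* The vanishing c (Suc n) lets the sum be extended before the index shift. *)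
    have "D (\<lambda>z. \<Sum>j\<le>n. c j * B j z) z = (\<Sum>j\<le>Suc n. c j * (s * of_nat j * B (j - 1) z))"
      using Suc.prems by (simp add: lower)
    also have "\<dots> = (\<Sum>j\<le>n. ?c j * B j z)"
      by (subst sum.atMost_Suc_shift) (simp add: mult_ac)
    finally show "D (\<lambda>z. \<Sum>j\<le>n. c j * B j z) z = (\<Sum>j\<le>n. ?c j * B j z)" .
  qed
  then have "(D ^^ Suc k) (\<lambda>z. \<Sum>j\<le>n. c j * B j z) r = s ^ k * fact k * ?c k"
    using Suc.IH[of ?c] Suc.prems by (simp only: funpow_Suc_right o_apply) simp
  then show ?case by (simp add: mult_ac)
qed

text \<open>
  Both products share the factors \<open>z (z - \<beta>) \<dots> (z - (j - 2) \<beta>)\<close>; the remaining ones differ by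
  \<open>(z + \<beta>) - (z - (j - 1) \<beta>) = j \<beta>\<close>.
\<close>
lemma gfact_difference:
  fixes z \<beta> :: "'a::comm_ring_1"
  shows "gfact (z + \<beta>) j (-\<beta>) - gfact z j (-\<beta>) = \<beta> * of_nat j * gfact z (j - 1) (-\<beta>)"
proof (cases j)
  case 0
  then show ?thesis by (simp add: gfact_def)
next
  case (Suc m)
  have "gfact (z + \<beta>) (Suc m) (-\<beta>) = (z + \<beta>) * gfact z m (-\<beta>)"
    unfolding gfact_def prod.lessThan_Suc_shift by (simp add: algebra_simps)
  moreover have "gfact z (Suc m) (-\<beta>) = (z - of_nat m * \<beta>) * gfact z m (-\<beta>)"
    by (simp add: gfact_def mult_ac)
  ultimately show ?thesis using Suc by (simp add: algebra_simps)
qed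

lemma gfact_zero_base: "gfact 0 j \<alpha> = (if j = 0 then 1 else 0)"
  unfolding gfact_def by (cases j) (simp_all add: prod.lessThan_Suc_shift del: prod.lessThan_Suc)

lemma fdiff_newton_sum:
  fixes \<beta> r :: "'a::comm_ring_1"
  shows "fdiff \<beta> (\<lambda>z. \<Sum>j\<le>n. c j * gfact (z - r) j (-\<beta>)) =
         (\<lambda>z. \<Sum>j\<le>n. c j * (\<beta> * of_nat j * gfact (z - r) (j - 1) (-\<beta>)))"
proof
  fix z
  have "gfact (z + \<beta> - r) j (-\<beta>) - gfact (z - r) j (-\<beta>) =
        \<beta> * of_nat j * gfact (z - r) (j - 1) (-\<beta>)" for j
    using gfact_difference[of "z - r" \<beta> j] by (simp add: algebra_simps)
  then show "fdiff \<beta> (\<lambda>z. \<Sum>j\<le>n. c j * gfact (z - r) j (-\<beta>)) z =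
             (\<Sum>j\<le>n. c j * (\<beta> * of_nat j * gfact (z - r) (j - 1) (-\<beta>)))"
    by (simp add: fdiff_def sum_subtractf[symmetric] right_diff_distrib[symmetric])
qed

lemma deriv_taylor_sum:
  fixes r :: "'a::real_normed_field"
  shows "deriv (\<lambda>z. \<Sum>j\<le>n. c j * (z - r) ^ j) =
         (\<lambda>z. \<Sum>j\<le>n. c j * (of_nat j * (z - r) ^ (j - 1)))"
  by (intro ext DERIV_imp_deriv) (auto intro!: derivative_eq_intros sum.cong)

lemma gen_stirling_expansion:
  fixes \<alpha> \<beta> r :: "'a::real_normed_field"
  shows "\<forall>j>n. gen_stirling n j \<alpha> \<beta> r = 0"
    and "gfact z n (-\<alpha>) = (\<Sum>j\<le>n. gen_stirling n j \<alpha> \<beta> r * gfact (z - r) j (-\<beta>))"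
  using theI'[OF gen_stirling_ex1[of n \<alpha> r \<beta>]] unfolding gen_stirling_def by blast+

theorem gen_stirling_eq_gen_divided_difference:
  fixes \<alpha> \<beta> r :: "'a::real_normed_field"
  shows "gen_stirling n k \<alpha> \<beta> r = gen_divided_difference \<beta> k (\<lambda>z. gfact z n (-\<alpha>)) r"
proof -
  let ?c = "\<lambda>j. gen_stirling n j \<alpha> \<beta> r"
  have expansion: "(\<lambda>z. gfact z n (-\<alpha>)) = (\<lambda>z. \<Sum>j\<le>n. ?c j * gfact (z - r) j (-\<beta>))"
    using gen_stirling_expansion(2) by blast
  note support = gen_stirling_expansion(1)[of n \<alpha> \<beta> r]
  show ?thesis
  proof (cases "\<beta> = 0")
    case True
    have "(deriv ^^ k) (\<lambda>z. \<Sum>j\<le>n. ?c j * (z - r) ^ j) r = 1 ^ k * fact k * ?c k"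
      by (rule lowering_operator_coefficient)
        (simp_all add: deriv_taylor_sum support power_0_left)
    then show ?thesis
      using True by (simp add: gen_divided_difference_def expansion gfact_zero_step)
  next
    case False
    have "(fdiff \<beta> ^^ k) (\<lambda>z. \<Sum>j\<le>n. ?c j * gfact (z - r) j (-\<beta>)) r = \<beta> ^ k * fact k * ?c k"
      by (rule lowering_operator_coefficient)
        (simp_all add: fdiff_newton_sum support gfact_zero_base)
    then show ?thesis
      using False by (simp add: gen_divided_difference_def expansion)
  qed
qed

text \<open>
  Dropping the first point of the progression gives the progression started at \<open>t + \<beta>\<close>, so the
  numerator of the recursion is a difference \<open>\<Delta>\<^sub>\<beta>\<close> in \<open>t\<close>, and its denominator
  \<open>t\<^sub>k\<^sub>+\<^sub>1 - t\<^sub>0 = (k + 1) \<beta>\<close> supplies the next factor of \<open>\<beta>\<^sup>k k!\<close>.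
\<close>
lemma divided_difference_equidistant:
  fixes \<beta> t :: "'a::field_char_0"
  assumes "\<beta> \<noteq> 0"
  shows "divided_difference f (\<lambda>i. t + of_nat i * \<beta>) k =
         1 / (\<beta> ^ k * fact k) * (fdiff \<beta> ^^ k) f t"
proof (induction k arbitrary: t)
  case 0
  then show ?case by simp
next
  case (Suc k)
  have shift: "(\<lambda>i. t + of_nat (Suc i) * \<beta>) = (\<lambda>i. (t + \<beta>) + of_nat i * \<beta>)"
    by (simp add: algebra_simps)
  have "divided_difference f (\<lambda>i. t + of_nat i * \<beta>) (Suc k) =
        (1 / (\<beta> ^ k * fact k) * (fdiff \<beta> ^^ k) f (t + \<beta>) -
         1 / (\<beta> ^ k * fact k) * (fdiff \<beta> ^^ k) f t) / (of_nat (Suc k) * \<beta>)"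
    by (simp only: divided_difference.simps shift Suc.IH) simp
  also have "\<dots> = 1 / (\<beta> ^ Suc k * fact (Suc k)) *
                 ((fdiff \<beta> ^^ k) f (t + \<beta>) - (fdiff \<beta> ^^ k) f t)"
    by (simp add: right_diff_distrib[symmetric] diff_divide_distrib[symmetric] mult_ac)
  also have "(fdiff \<beta> ^^ k) f (t + \<beta>) - (fdiff \<beta> ^^ k) f t = (fdiff \<beta> ^^ Suc k) f t"
    by (simp add: fdiff_def)
  finally show ?case .
qed

lemma gen_stirling_eq_fdiff:
  fixes \<alpha> \<beta> r :: "'a::real_normed_field"
  assumes "\<beta> \<noteq> 0"
  shows "gen_stirling n k \<alpha> \<beta> r =
         1 / (\<beta> ^ k * fact k) * (fdiff \<beta> ^^ k) (\<lambda>z. gfact z n (-\<alpha>)) r"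
  using assms by (simp add: gen_stirling_eq_gen_divided_difference gen_divided_difference_def)

lemma gen_stirling_eq_divided_difference:
  fixes \<alpha> \<beta> r :: "'a::real_normed_field"
  assumes "\<beta> \<noteq> 0"
  shows "gen_stirling n k \<alpha> \<beta> r =
         divided_difference (\<lambda>z. gfact z n (-\<alpha>)) (\<lambda>i. r + of_nat i * \<beta>) k"
  by (simp only: gen_stirling_eq_fdiff[OF assms] divided_difference_equidistant[OF assms])

lemma gen_stirling_eq_deriv:
  fixes \<alpha> r :: "'a::real_normed_field"
  shows "gen_stirling n k \<alpha> 0 r = 1 / fact k * (deriv ^^ k) (\<lambda>z. gfact z n (-\<alpha>)) r"
  by (simp add: gen_stirling_eq_gen_divided_difference gen_divided_difference_def)

lemma stirling_fst_eq_gen_stirling: "stirling_fst n k = gen_stirling n k 1 0 0"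
  by (simp add: stirling_fst_def gen_stirling_def falling_fact_def gfact_zero_step)

lemma stirling_snd_eq_gen_stirling: "stirling_snd n k = gen_stirling n k 0 1 0"
  by (simp add: stirling_snd_def gen_stirling_def falling_fact_def gfact_zero_step)

theorem theorem2p2:
  fixes n k :: nat
    and \<alpha> \<beta> r :: "'a::real_normed_field"
    and S1 S2 :: "nat \<Rightarrow> nat \<Rightarrow> 'a"
  assumes "(\<alpha>, \<beta>, r) \<noteq> (0, 0, 0)"
    and "S1 = (\<lambda>n k. gen_stirling n k \<alpha> \<beta> r)"
    and "S2 = (\<lambda>n k. gen_stirling n k \<beta> \<alpha> (- r))"
  shows
    "(gen_stirling n k \<alpha> \<beta> r = gen_divided_difference \<beta> k (\<lambda>z. gfact z n (-\<alpha>)) r \<and>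
      (\<beta> \<noteq> 0 \<longrightarrow>
        gen_stirling n k \<alpha> \<beta> r
          = 1 / (\<beta> ^ k * fact k) * (fdiff \<beta> ^^ k) (\<lambda>z. gfact z n (-\<alpha>)) r \<and>
        gen_stirling n k \<alpha> \<beta> r
          = divided_difference (\<lambda>z. gfact z n (-\<alpha>)) (\<lambda>i. r + of_nat i * \<beta>) k) \<and>
      (\<beta> = 0 \<longrightarrow>
        gen_stirling n k \<alpha> \<beta> r = 1 / fact k * (deriv ^^ k) (\<lambda>z. gfact z n (-\<alpha>)) r)) \<and>
     (S1 n k = gen_divided_difference \<beta> k (\<lambda>z. gfact z n (-\<alpha>)) r \<and>
      (\<beta> \<noteq> 0 \<longrightarrow>
        S1 n k = 1 / (\<beta> ^ k * fact k) * (fdiff \<beta> ^^ k) (\<lambda>z. gfact z n (-\<alpha>)) r \<and>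
        S1 n k = divided_difference (\<lambda>z. gfact z n (-\<alpha>)) (\<lambda>i. r + of_nat i * \<beta>) k) \<and>
      (\<beta> = 0 \<longrightarrow>
        S1 n k = 1 / fact k * (deriv ^^ k) (\<lambda>z. gfact z n (-\<alpha>)) r)) \<and>
     (S2 n k = gen_divided_difference \<alpha> k (\<lambda>z. gfact z n (-\<beta>)) (- r) \<and>
      (\<alpha> \<noteq> 0 \<longrightarrow>
        S2 n k = 1 / (\<alpha> ^ k * fact k) * (fdiff \<alpha> ^^ k) (\<lambda>z. gfact z n (-\<beta>)) (- r) \<and>
        S2 n k = divided_difference (\<lambda>z. gfact z n (-\<beta>)) (\<lambda>i. - r + of_nat i * \<alpha>) k) \<and>
      (\<alpha> = 0 \<longrightarrow>
        S2 n k = 1 / fact k * (deriv ^^ k) (\<lambda>z. gfact z n (-\<beta>)) (- r))) \<and>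
     ((stirling_fst n k :: 'a) = gen_stirling n k 1 0 0 \<and>
      (gen_stirling n k 1 0 0 :: 'a) = 1 / fact k * (deriv ^^ k) (\<lambda>z. falling_fact z n) 0) \<and>
     ((stirling_snd n k :: 'a) = gen_stirling n k 0 1 0 \<and>
      (gen_stirling n k 0 1 0 :: 'a) = divided_difference (\<lambda>z. z ^ n) (\<lambda>i. of_nat i) k)"
proof -
  have fst_deriv: "(gen_stirling n k 1 0 0 :: 'a) =
      1 / fact k * (deriv ^^ k) (\<lambda>z. falling_fact z n) 0"
    by (simp add: gen_stirling_eq_deriv falling_fact_def)
  have snd_divided: "(gen_stirling n k 0 1 0 :: 'a) =
      divided_difference (\<lambda>z. z ^ n) (\<lambda>i. of_nat i) k"
    using gen_stirling_eq_divided_difference[of "1 :: 'a" n k 0 0] by (simp add: gfact_zero_step)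
  show ?thesis
    unfolding assms(2,3)
    by (intro conjI impI fst_deriv snd_divided stirling_fst_eq_gen_stirling
        stirling_snd_eq_gen_stirling gen_stirling_eq_gen_divided_difference
        gen_stirling_eq_fdiff gen_stirling_eq_divided_difference)
      (simp_all only: gen_stirling_eq_deriv not_False_eq_True)
qed

end
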